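(* Let $S_\eta$, $G$, $L:=G^{-T}$, $G_t$, $E:=G_t-G$, $S_\phi=G_t^TS_\eta G_t$ and $D_\phi=\mathrm{diag}\,S_\phi$ be the matrices described in the context; in particular $L$ is the lower-triangular Cholesky factor of $S_\eta$. Assume that $\|L^TE\|<1$. Then the eigenvalues $\lambda$ of the generalized eigenvalue problem $S_\phi x=\lambda D_\phi x$ satisfy $$\frac{(1-\|L^TE\|)^2}{1+\max_i\|(L^TE)_{:,i}\|^2}\ \le\ \lambda\ \le\ \bigl(1+\|L^TED_\phi^{-1/2}\|\bigr)^2 .$$
   Context: Let $L_k$ be the Legendre polynomials on $I=(-1,1)$ ($L_k(1)=1$) and, for $k\ge2$, $\eta_k=\frac1{\sqrt{4k-2}}(L_{k-2}-L_k)$ (the univariate Babuška–Shen basis). Let $\Omega=(-1,1)^2$, and for $k=(k_1,k_2)\in\mathcal K=\{k\in\mathbb N^2: k_1,k_2\ge2\}$ let $\eta_k(x)=\eta_{k_1}(x_1)\eta_{k_2}(x_2)$. The inner product is $(u,v)_{H^1_0(\Omega)}=\int_\Omega\nabla u\cdot\nabla v$. The functions $\eta_k$ split into four mutually $H^1_0$-orthogonal families according to the parity of $k_1$ and of $k_2$; fix one family, normalize its functions to have unit $H^1_0(\Omega)$-norm (keeping the notation $\eta_k$, and $\mathcal K$ for the corresponding index set), and order the indices by increasing total degree $k_1+k_2$ and, for equal total degree, by increasing $k_1$. $S_\eta$ is the semi-infinite matrix with entries $(\eta_k,\eta_m)_{H^1_0(\Omega)}$; its diagonal entries equal $1$. Gram–Schmidt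 orthonormalization gives an upper triangular matrix $G=(g_{mk})$ with nonzero diagonal (in the given ordering) such that the functions $\Phi_k=\sum_{m\le k}g_{mk}\eta_m$ are $H^1_0$-orthonormal, i.e. $G^TS_\eta G=I$; thus $S_\eta=LL^T$ with $L=G^{-T}$ lower triangular. $G_t$ is a matrix obtained from $G$ by setting to zero a certain finite set of entries, with $\mathrm{diag}(G_t)=\mathrm{diag}(G)$; $E=G_t-G$, so $\mathrm{diag}(E)=0$ and $E$ has finitely many nonzero entries. $D_\phi$ is the diagonal matrix with the same diagonal as $S_\phi=G_t^TS_\eta G_t$. $\|\cdot\|$ is the Euclidean ($\ell^2$) vector norm and the induced matrix norm; $(A)_{:,i}$ is the $i$-th column of $A$. *)

theory Defs
  imports "HOL-Analysis.Analysis" "HOL-Computational_Algebra.Polynomial"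
begin

section \<open>Babuska-Shen basis on the square\<close>

text \<open>Bonnet's recurrence, which gives the normalisation \<open>L\<^sub>k(1) = 1\<close>.\<close>

fun legendre :: "nat \<Rightarrow> real poly" where
  "legendre 0 = 1"
| "legendre (Suc 0) = [:0, 1:]"
| "legendre (Suc (Suc n)) =
     smult (1 / real (n + 2))
       (smult (real (2 * n + 3)) ([:0, 1:] * legendre (Suc n)) - smult (real (n + 1)) (legendre n))"

definition bs1 :: "nat \<Rightarrow> real \<Rightarrow> real" where
  "bs1 k t = 1 / sqrt (4 * real k - 2) * (poly (legendre (k - 2)) t - poly (legendre k) t)"

definition bs2 :: "nat \<times> nat \<Rightarrow> real \<times> real \<Rightarrow> real" where
  "bs2 k x = bs1 (fst k) (fst x) * bs1 (snd k) (snd x)"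

definition Omega :: "(real \<times> real) set" where
  "Omega = {-1<..<1} \<times> {-1<..<1}"

definition grad :: "(real \<times> real \<Rightarrow> real) \<Rightarrow> real \<times> real \<Rightarrow> real \<times> real" where
  "grad u x = (THE D. GDERIV u x :> D)"

definition h10_inner :: "(real \<times> real \<Rightarrow> real) \<Rightarrow> (real \<times> real \<Rightarrow> real) \<Rightarrow> real" where
  "h10_inner u v = (LINT x:Omega|lborel. grad u x \<bullet> grad v x)"

definition eta :: "nat \<times> nat \<Rightarrow> real \<times> real \<Rightarrow> real" where
  "eta k x = bs2 k x / sqrt (h10_inner (bs2 k) (bs2 k))"

text \<open>The two parameters select one of the four parity families.\<close>

definition family :: "bool \<Rightarrow> bool \<Rightarrow> (nat \<times> nat) set" where
  "family p q = {(k1, k2). 2 \<le> k1 \<and> 2 \<le> k2 \<and> (even k1 \<longleftrightarrow> p) \<and> (even k2 \<longleftrightarrow> q)}"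

definition idx_less :: "nat \<times> nat \<Rightarrow> nat \<times> nat \<Rightarrow> bool" where
  "idx_less k m \<longleftrightarrow> fst k + snd k < fst m + snd m \<or>
     (fst k + snd k = fst m + snd m \<and> fst k < fst m)"

definition S_eta :: "nat \<times> nat \<Rightarrow> nat \<times> nat \<Rightarrow> real" where
  "S_eta k m = h10_inner (eta k) (eta m)"


section \<open>Infinite matrices and vectors over an index set\<close>

text \<open>A matrix over the index set \<open>K\<close> is a function of two indices of which only the values on
  \<open>K \<times> K\<close> matter; likewise for vectors.\<close>

type_synonym 'i matrix = "'i \<Rightarrow> 'i \<Rightarrow> real"

definition id_mat :: "'i matrix" where
  "id_mat i j = (if i = j then 1 else 0)"

definition mat_transpose :: "'i matrix \<Rightarrow> 'i matrix" where
  "mat_transpose A i j = A j i"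

definition mat_mult :: "'i set \<Rightarrow> 'i matrix \<Rightarrow> 'i matrix \<Rightarrow> 'i matrix" where
  "mat_mult K A B i j = (\<Sum>\<^sub>\<infinity>l\<in>K. A i l * B l j)"

definition mat_vec :: "'i set \<Rightarrow> 'i matrix \<Rightarrow> ('i \<Rightarrow> 'a::real_normed_vector) \<Rightarrow> 'i \<Rightarrow> 'a" where
  "mat_vec K A x i = (\<Sum>\<^sub>\<infinity>j\<in>K. A i j *\<^sub>R x j)"

definition mat_eq :: "'i set \<Rightarrow> 'i matrix \<Rightarrow> 'i matrix \<Rightarrow> bool" where
  "mat_eq K A B \<longleftrightarrow> (\<forall>i\<in>K. \<forall>j\<in>K. A i j = B i j)"

definition diag_part :: "'i matrix \<Rightarrow> 'i matrix" where
  "diag_part A i j = (if i = j then A i i else 0)"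

definition diag_inv_sqrt :: "'i matrix \<Rightarrow> 'i matrix" where
  "diag_inv_sqrt D i j = (if i = j then 1 / sqrt (D i i) else 0)"

definition upper_triangular_on :: "(nat \<times> nat) set \<Rightarrow> (nat \<times> nat) matrix \<Rightarrow> bool" where
  "upper_triangular_on K A \<longleftrightarrow> (\<forall>m\<in>K. \<forall>k\<in>K. idx_less k m \<longrightarrow> A m k = 0)"

definition lower_triangular_on :: "(nat \<times> nat) set \<Rightarrow> (nat \<times> nat) matrix \<Rightarrow> bool" where
  "lower_triangular_on K A \<longleftrightarrow> upper_triangular_on K (mat_transpose A)"

definition mat_inverse_on :: "'i set \<Rightarrow> 'i matrix \<Rightarrow> 'i matrix \<Rightarrow> bool" where
  "mat_inverse_on K A B \<longleftrightarrow>
     mat_eq K (mat_mult K A B) id_mat \<and> mat_eq K (mat_mult K B A) id_mat"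

definition in_l2 :: "'i set \<Rightarrow> ('i \<Rightarrow> 'a::real_normed_vector) \<Rightarrow> bool" where
  "in_l2 K x \<longleftrightarrow> (\<lambda>i. (norm (x i))\<^sup>2) summable_on K"

definition l2_norm :: "'i set \<Rightarrow> ('i \<Rightarrow> 'a::real_normed_vector) \<Rightarrow> real" where
  "l2_norm K x = sqrt (\<Sum>\<^sub>\<infinity>i\<in>K. (norm (x i))\<^sup>2)"

text \<open>Meaningful for matrices that act boundedly on \<open>\<ell>\<^sup>2(K)\<close>, in particular for matrices with
  finitely many nonzero entries.\<close>

definition mat_norm :: "'i set \<Rightarrow> 'i matrix \<Rightarrow> real" where
  "mat_norm K A =
     Sup {l2_norm K (mat_vec K A x) | x :: 'i \<Rightarrow> real. in_l2 K x \<and> l2_norm K x \<le> 1}"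

text \<open>Eigenvectors are sought in complex \<open>\<ell>\<^sup>2(K)\<close>, so that real eigenvalues are not presupposed.\<close>

definition gen_eigenvalue :: "'i set \<Rightarrow> 'i matrix \<Rightarrow> 'i matrix \<Rightarrow> complex \<Rightarrow> bool" where
  "gen_eigenvalue K A B \<mu> \<longleftrightarrow>
     (\<exists>x :: 'i \<Rightarrow> complex. in_l2 K x \<and> (\<exists>i\<in>K. x i \<noteq> 0) \<and>
        (\<forall>i\<in>K. mat_vec K A x i = \<mu> * mat_vec K B x i))"

end

theory Submission
  imports Defs
begin

text \<open>Every index has only finitely many predecessors, so all matrix products are finite sums and
  \<open>F = L\<^sup>TE\<close> has finitely many nonzero entries. Since \<open>GL\<^sup>T = I\<close>, one gets \<open>G\<^sub>t = G(I + F)\<close> and hence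
  \<open>S\<^sub>\<phi> = (I + F)\<^sup>T(I + F)\<close>; as \<open>F\<close> is strictly upper triangular, \<open>D\<^sub>\<phi>\<close> has the entries
  \<open>1 + \<parallel>F\<^bsub>:,i\<^esub>\<parallel>\<^sup>2\<close>. An eigenvector \<open>x\<close> then satisfies \<open>\<parallel>(I + F)x\<parallel>\<^sup>2 = \<mu> \<langle>x, D\<^sub>\<phi>x\<rangle>\<close>, and both bounds
  follow from the triangle inequality, the upper one after substituting \<open>y = D\<^sub>\<phi>\<^bsup>1/2\<^esup>x\<close>.\<close>

section \<open>Square-summable vectors\<close>

lemma l2_norm_nonneg: "0 \<le> l2_norm K x"
  unfolding l2_norm_def by (simp add: infsum_nonneg)

lemma l2_norm_power2: "(l2_norm K x)\<^sup>2 = (\<Sum>\<^sub>\<infinity>i\<in>K. (norm (x i))\<^sup>2)"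
  unfolding l2_norm_def by (simp add: infsum_nonneg)

lemma l2_norm_cong: "(\<And>i. i \<in> K \<Longrightarrow> x i = y i) \<Longrightarrow> l2_norm K x = l2_norm K y"
  unfolding l2_norm_def by (metis (mono_tags, lifting) infsum_cong)

lemma in_l2_finite_support:
  assumes "finite T" "\<And>i. i \<in> K - T \<Longrightarrow> x i = 0"
  shows "in_l2 K x"
  unfolding in_l2_def
  by (rule summable_on_cong_neutral[THEN iffD1, OF _ _ _ summable_on_finite[of "K \<inter> T"]])
    (use assms in auto)

lemma l2_norm_finite_support:
  assumes "finite T" "T \<subseteq> K" "\<And>i. i \<in> K - T \<Longrightarrow> x i = 0"
  shows "l2_norm K x = L2_set (\<lambda>i. norm (x i)) T"
proof -
  have "(\<Sum>\<^sub>\<infinity>i\<in>K. (norm (x i))\<^sup>2) = (\<Sum>\<^sub>\<infinity>i\<in>T. (norm (x i))\<^sup>2)"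
    by (rule infsum_cong_neutral) (use assms in auto)
  then show ?thesis
    using assms(1) by (simp add: l2_norm_def L2_set_def)
qed

lemma L2_set_le_l2_norm:
  assumes "in_l2 K x" "finite T" "T \<subseteq> K"
  shows "L2_set (\<lambda>i. norm (x i)) T \<le> l2_norm K x"
  unfolding L2_set_def l2_norm_def
  using assms by (intro real_sqrt_le_mono finite_sum_le_infsum) (auto simp: in_l2_def)

lemma norm_le_l2_norm:
  assumes "in_l2 K x" "i \<in> K"
  shows "norm (x i) \<le> l2_norm K x"
  using L2_set_le_l2_norm[OF assms(1), of "{i}"] assms(2) by (simp add: L2_set_def)

text \<open>A series of nonnegative terms is the supremum of its finite partial sums. Inequalities
  known for \<open>L2_set\<close> on finite sets therefore pass to \<open>K\<close>, with
  square-summability as a by-product.\<close>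

lemma l2_norm_bounded_by_finite:
  assumes "\<And>T. finite T \<Longrightarrow> T \<subseteq> K \<Longrightarrow> L2_set (\<lambda>i. norm (x i)) T \<le> B" "0 \<le> B"
  shows "in_l2 K x" "l2_norm K x \<le> B"
proof -
  have *: "(\<Sum>i\<in>T. (norm (x i))\<^sup>2) \<le> B\<^sup>2" if "finite T" "T \<subseteq> K" for T
    using assms(1)[OF that] assms(2) by (simp add: L2_set_def sqrt_le_D)
  show "in_l2 K x"
    unfolding in_l2_def
    by (rule nonneg_bdd_above_summable_on) (use * in \<open>auto intro!: bdd_aboveI\<close>)
  then have "(\<Sum>\<^sub>\<infinity>i\<in>K. (norm (x i))\<^sup>2) \<le> B\<^sup>2"
    unfolding in_l2_def by (rule infsum_le_finite_sums) (use * in auto)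
  then show "l2_norm K x \<le> B"
    unfolding l2_norm_def using assms(2) by (rule real_le_lsqrt[rotated 1])
qed

text \<open>Minkowski's inequality on each finite \<open>T\<close>, with a right-hand side that is
  then made independent of \<open>T\<close>.\<close>

lemma l2_add:
  assumes "in_l2 K x" "in_l2 K y"
  shows in_l2_add: "in_l2 K (\<lambda>i. x i + y i)"
    and l2_norm_triangle: "l2_norm K (\<lambda>i. x i + y i) \<le> l2_norm K x + l2_norm K y"
proof -
  have "L2_set (\<lambda>i. norm (x i + y i)) T \<le> l2_norm K x + l2_norm K y"
    if T: "finite T" "T \<subseteq> K" for T
  proof -
    have "L2_set (\<lambda>i. norm (x i + y i)) T \<le> L2_set (\<lambda>i. norm (x i) + norm (y i)) T"
      by (intro L2_set_mono norm_triangle_ineq) auto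
    also have "\<dots> \<le> L2_set (\<lambda>i. norm (x i)) T + L2_set (\<lambda>i. norm (y i)) T"
      by (rule L2_set_triangle_ineq)
    also have "\<dots> \<le> l2_norm K x + l2_norm K y"
      by (intro add_mono L2_set_le_l2_norm assms T)
    finally show ?thesis .
  qed
  note * = l2_norm_bounded_by_finite[OF this add_nonneg_nonneg[OF l2_norm_nonneg l2_norm_nonneg]]
  show "in_l2 K (\<lambda>i. x i + y i)" "l2_norm K (\<lambda>i. x i + y i) \<le> l2_norm K x + l2_norm K y"
    by (rule *; simp)+
qed

text \<open>Comparison with the sum of the squares, since 0 <= ab and 2ab <= a^2 + b^2 give ab <=
  a^2 + b^2.\<close>

lemma in_l2_mult_summable:
  fixes x y :: "'i \<Rightarrow> complex"
  assumes "in_l2 K x" "in_l2 K y"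
  shows "(\<lambda>i. x i * y i) summable_on K"
proof (rule abs_summable_summable, rule summable_on_comparison_test)
  show "(\<lambda>i. (norm (x i))\<^sup>2 + (norm (y i))\<^sup>2) summable_on K"
    using assms unfolding in_l2_def by (rule summable_on_add)
  show "norm (x i * y i) \<le> (norm (x i))\<^sup>2 + (norm (y i))\<^sup>2" for i
    using sum_squares_bound[of "norm (x i)" "norm (y i)"]
      mult_nonneg_nonneg[OF norm_ge_zero[of "x i"] norm_ge_zero[of "y i"]]
    unfolding norm_mult by linarith
qed auto

lemma l2_norm_pos:
  assumes "in_l2 K x" "i \<in> K" "x i \<noteq> 0"
  shows "0 < l2_norm K x"
  using norm_le_l2_norm[OF assms(1,2)] assms(3) by (meson less_le_trans zero_less_norm_iff)


section \<open>Matrices with finite rows or columns\<close>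

text \<open>An \<open>infsum\<close> takes the value 0 when it does not converge, so linearity and
  associativity cannot be taken for granted. Finite rows or columns turn the sums concerned into
  finite ones.\<close>

definition row_finite :: "'i set \<Rightarrow> 'i matrix \<Rightarrow> bool" where
  "row_finite K A \<longleftrightarrow> (\<forall>i\<in>K. finite {j\<in>K. A i j \<noteq> 0})"

definition col_finite :: "'i set \<Rightarrow> 'i matrix \<Rightarrow> bool" where
  "col_finite K A \<longleftrightarrow> row_finite K (mat_transpose A)"

definition finite_support :: "'i set \<Rightarrow> 'i matrix \<Rightarrow> bool" where
  "finite_support K A \<longleftrightarrow> finite {(i, j). i \<in> K \<and> j \<in> K \<and> A i j \<noteq> 0}"

section \<open>Transposes, finite expansions of products, associativity\<close>

lemma mat_transpose_transpose [simp]: "mat_transpose (mat_transpose A) = A"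
  by (simp add: mat_transpose_def fun_eq_iff)

lemma mat_transpose_mult:
  "mat_transpose (mat_mult K A B) = mat_mult K (mat_transpose B) (mat_transpose A)"
  by (simp add: mat_transpose_def mat_mult_def fun_eq_iff mult.commute)

lemma mat_mult_eq_mat_vec: "mat_mult K A B i j = mat_vec K A (\<lambda>l. B l j) i"
  by (simp add: mat_mult_def mat_vec_def)

lemma mat_vec_eq_sum:
  assumes "finite T" "T \<subseteq> K" "\<And>j. j \<in> K - T \<Longrightarrow> A i j *\<^sub>R x j = 0"
  shows "mat_vec K A x i = (\<Sum>j\<in>T. A i j *\<^sub>R x j)"
proof -
  have "mat_vec K A x i = (\<Sum>\<^sub>\<infinity>j\<in>T. A i j *\<^sub>R x j)"
    unfolding mat_vec_def by (rule infsum_cong_neutral) (use assms in auto)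
  then show ?thesis
    using assms(1) by simp
qed

lemma mat_mult_eq_sum:
  assumes "finite T" "T \<subseteq> K" "\<And>l. l \<in> K - T \<Longrightarrow> A i l = 0 \<or> B l j = 0"
  shows "mat_mult K A B i j = (\<Sum>l\<in>T. A i l * B l j)"
  unfolding mat_mult_eq_mat_vec by (subst mat_vec_eq_sum[OF assms(1,2)]) (use assms(3) in auto)

lemma mat_mult_cong:
  assumes "\<And>l. l \<in> K \<Longrightarrow> A i l = A' i l" "\<And>l. l \<in> K \<Longrightarrow> B l j = B' l j"
  shows "mat_mult K A B i j = mat_mult K A' B' i j"
  unfolding mat_mult_def by (intro infsum_cong) (simp add: assms)

lemma mat_vec_cong:
  assumes "\<And>j. j \<in> K \<Longrightarrow> A i j = A' i j" "\<And>j. j \<in> K \<Longrightarrow> x j = x' j"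
  shows "mat_vec K A x i = mat_vec K A' x' i"
  unfolding mat_vec_def by (intro infsum_cong) (simp add: assms)

lemma mat_mult_id_left:
  assumes "i \<in> K"
  shows "mat_mult K id_mat A i j = A i j"
  by (subst mat_mult_eq_sum[of "{i}"]) (use assms in \<open>auto simp: id_mat_def\<close>)

lemma mat_mult_id_right:
  assumes "j \<in> K"
  shows "mat_mult K A id_mat i j = A i j"
  by (subst mat_mult_eq_sum[of "{j}"]) (use assms in \<open>auto simp: id_mat_def\<close>)

text \<open>Row \<open>i\<close> of \<open>A\<close> meets only the rows of \<open>B\<close> in the
  finite set \<open>R\<close>, and these meet only the columns in the finite set \<open>U\<close>.
  Both sides are double sums over \<open>R\<close> and \<open>U\<close>, so \<open>x\<close> may be
  arbitrary.\<close>

lemma mat_vec_mult: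
  assumes A: "row_finite K A" and B: "row_finite K B" and i: "i \<in> K"
  shows "mat_vec K (mat_mult K A B) x i = mat_vec K A (mat_vec K B x) i"
proof -
  define R where "R = {l\<in>K. A i l \<noteq> 0}"
  define U where "U = (\<Union>l\<in>R. {j\<in>K. B l j \<noteq> 0})"
  have R: "finite R" "R \<subseteq> K"
    using A i by (auto simp: R_def row_finite_def)
  have U: "finite U" "U \<subseteq> K"
    using B R by (auto simp: U_def row_finite_def)
  have AB: "mat_mult K A B i j = (\<Sum>l\<in>R. A i l * B l j)" for j
    by (rule mat_mult_eq_sum[OF R]) (auto simp: R_def)
  have "mat_vec K (mat_mult K A B) x i = (\<Sum>j\<in>U. mat_mult K A B i j *\<^sub>R x j)"
  proof (rule mat_vec_eq_sum[OF U])
    fix j assume "j \<in> K - U"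
    then have "\<And>l. l \<in> R \<Longrightarrow> B l j = 0"
      by (auto simp: U_def)
    then show "mat_mult K A B i j *\<^sub>R x j = 0"
      by (simp add: AB)
  qed
  also have "\<dots> = (\<Sum>l\<in>R. \<Sum>j\<in>U. A i l *\<^sub>R B l j *\<^sub>R x j)"
    by (subst sum.swap) (simp add: AB scaleR_sum_left)
  also have "\<dots> = (\<Sum>l\<in>R. A i l *\<^sub>R mat_vec K B x l)"
  proof (rule sum.cong[OF refl])
    fix l assume "l \<in> R"
    then have "mat_vec K B x l = (\<Sum>j\<in>U. B l j *\<^sub>R x j)"
      by (intro mat_vec_eq_sum[OF U]) (auto simp: U_def)
    then show "(\<Sum>j\<in>U. A i l *\<^sub>R B l j *\<^sub>R x j) = A i l *\<^sub>R mat_vec K B x l"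
      by (simp add: scaleR_sum_right)
  qed
  also have "\<dots> = mat_vec K A (mat_vec K B x) i"
    by (rule mat_vec_eq_sum[symmetric, OF R]) (auto simp: R_def)
  finally show ?thesis .
qed

lemma mat_vec_row_finite:
  assumes "row_finite K A" "i \<in> K"
  shows "mat_vec K A x i = (\<Sum>j\<in>{j\<in>K. A i j \<noteq> 0}. A i j *\<^sub>R x j)"
  by (rule mat_vec_eq_sum) (use assms in \<open>auto simp: row_finite_def\<close>)

lemma mat_mult_assoc_row:
  assumes "row_finite K A" "row_finite K B" "i \<in> K"
  shows "mat_mult K (mat_mult K A B) C i j = mat_mult K A (mat_mult K B C) i j"
  using mat_vec_mult[OF assms, of "\<lambda>l. C l j"] by (simp add: mat_mult_eq_mat_vec)

lemma mat_mult_assoc_col: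
  assumes "col_finite K B" "col_finite K C" "j \<in> K"
  shows "mat_mult K (mat_mult K A B) C i j = mat_mult K A (mat_mult K B C) i j"
proof -
  have "mat_mult K (mat_mult K A B) C i j = mat_transpose (mat_mult K (mat_mult K A B) C) j i"
    by (simp add: mat_transpose_def)
  also have "\<dots> = mat_transpose (mat_mult K A (mat_mult K B C)) j i"
    using assms by (simp add: mat_transpose_mult mat_mult_assoc_row col_finite_def)
  finally show ?thesis
    by (simp add: mat_transpose_def)
qed

text \<open>The outer factors cut both sums down to finite sets, so the middle factor may have
  infinite rows and columns. This covers products with \<open>S_eta\<close> in the middle.\<close>

lemma mat_mult_assoc_row_col:
  assumes A: "row_finite K A" and C: "col_finite K C" and ij: "i \<in> K" "j \<in> K"
  shows "mat_mult K (mat_mult K A B) C i j = mat_mult K A (mat_mult K B C) i j"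
proof -
  define R where "R = {l\<in>K. A i l \<noteq> 0}"
  define T where "T = {m\<in>K. C m j \<noteq> 0}"
  have R: "finite R" "R \<subseteq> K"
    using A ij by (auto simp: R_def row_finite_def)
  have T: "finite T" "T \<subseteq> K"
    using C ij by (auto simp: T_def row_finite_def col_finite_def mat_transpose_def)
  have AX: "mat_mult K A X i m = (\<Sum>l\<in>R. A i l * X l m)" for X m
    by (rule mat_mult_eq_sum[OF R]) (auto simp: R_def)
  have XC: "mat_mult K X C l j = (\<Sum>m\<in>T. X l m * C m j)" for X l
    by (rule mat_mult_eq_sum[OF T]) (auto simp: T_def)
  show ?thesis
    by (simp add: AX XC sum_distrib_left sum_distrib_right mult.assoc sum.swap[of _ R T])
qed

section \<open>Matrices with finitely many nonzero entries\<close>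

lemma finite_support_obtain:
  assumes "finite_support K A"
  obtains T where "finite T" "T \<subseteq> K"
    "\<And>i j. \<lbrakk>i \<in> K; j \<in> K; i \<notin> T \<or> j \<notin> T\<rbrakk> \<Longrightarrow> A i j = 0"
proof
  let ?P = "{(i, j). i \<in> K \<and> j \<in> K \<and> A i j \<noteq> 0}"
  show "finite (fst ` ?P \<union> snd ` ?P)"
    using assms unfolding finite_support_def by simp
  show "fst ` ?P \<union> snd ` ?P \<subseteq> K"
    by auto
  show "A i j = 0" if "i \<in> K" "j \<in> K" "i \<notin> fst ` ?P \<union> snd ` ?P \<or> j \<notin> fst ` ?P \<union> snd ` ?P" for i j
    using that by force
qed

lemma finite_supportI:
  assumes "finite T" "\<And>i j. \<lbrakk>i \<in> K; j \<in> K; A i j \<noteq> 0\<rbrakk> \<Longrightarrow> i \<in> T \<and> j \<in> T"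
  shows "finite_support K A"
  unfolding finite_support_def by (rule finite_subset[of _ "T \<times> T"]) (use assms in auto)

lemma finite_support_transpose:
  assumes "finite_support K A"
  shows "finite_support K (mat_transpose A)"
  unfolding finite_support_def
  by (rule finite_subset[OF _ finite_imageI[OF assms[unfolded finite_support_def], of prod.swap]])
    (auto simp: image_iff mat_transpose_def)

lemma finite_support_row_finite:
  assumes "finite_support K A"
  shows "row_finite K A"
  using assms
proof (rule finite_support_obtain)
  fix T assume T: "finite T" "\<And>i j. \<lbrakk>i \<in> K; j \<in> K; i \<notin> T \<or> j \<notin> T\<rbrakk> \<Longrightarrow> A i j = 0"
  show ?thesis
    unfolding row_finite_def by (intro ballI finite_subset[OF _ T(1)]) (use T(2) in auto)
qed

lemma finite_support_col_finite: "finite_support K A \<Longrightarrow> col_finite K A"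
  unfolding col_finite_def by (intro finite_support_row_finite finite_support_transpose)

text \<open>Nonzero columns of the product are nonzero columns of \<open>B\<close>. Its nonzero rows
  lie in the supports of the finitely many columns of \<open>A\<close> that \<open>B\<close> picks
  out.\<close>

lemma finite_support_mult:
  assumes A: "col_finite K A" and B: "finite_support K B"
  shows "finite_support K (mat_mult K A B)"
  using B
proof (rule finite_support_obtain)
  fix T assume T: "finite T" "T \<subseteq> K" "\<And>i j. \<lbrakk>i \<in> K; j \<in> K; i \<notin> T \<or> j \<notin> T\<rbrakk> \<Longrightarrow> B i j = 0"
  have AB: "mat_mult K A B i j = (\<Sum>l\<in>T. A i l * B l j)" if "j \<in> K" for i j
    by (rule mat_mult_eq_sum[OF T(1,2)]) (use T(3) that in auto)
  let ?U = "\<Union>l\<in>T. {i\<in>K. A i l \<noteq> 0}"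
  show ?thesis
  proof (rule finite_supportI[of "T \<union> ?U"])
    show "finite (T \<union> ?U)"
      using A T(1,2) by (auto simp: col_finite_def row_finite_def mat_transpose_def)
    fix i j assume ij: "i \<in> K" "j \<in> K" "mat_mult K A B i j \<noteq> 0"
    then obtain l where "l \<in> T" "A i l * B l j \<noteq> 0"
      using AB by (metis (no_types, lifting) sum.neutral)
    then show "i \<in> T \<union> ?U \<and> j \<in> T \<union> ?U"
      using ij T(2,3) by auto
  qed
qed

section \<open>Perturbations of the identity\<close>

lemma row_finite_add:
  assumes "row_finite K A" "row_finite K B"
  shows "row_finite K (\<lambda>i j. A i j + B i j)"
  unfolding row_finite_def
proof
  fix i assume "i \<in> K"
  with assms have "finite ({j\<in>K. A i j \<noteq> 0} \<union> {j\<in>K. B i j \<noteq> 0})"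
    by (simp add: row_finite_def)
  then show "finite {j\<in>K. A i j + B i j \<noteq> 0}"
    by (rule finite_subset[rotated]) auto
qed

lemma row_finite_id: "row_finite K id_mat"
  unfolding row_finite_def
proof
  show "finite {j\<in>K. id_mat i j \<noteq> 0}" for i
    by (rule finite_subset[of _ "{i}"]) (auto simp: id_mat_def)
qed

lemma mat_transpose_id_add:
  "mat_transpose (\<lambda>i j. id_mat i j + F i j) = (\<lambda>i j. id_mat i j + mat_transpose F i j)"
  by (auto simp: mat_transpose_def id_mat_def fun_eq_iff)

lemma mat_vec_id_add:
  assumes "row_finite K F" "i \<in> K"
  shows "mat_vec K (\<lambda>i j. id_mat i j + F i j) x i = x i + mat_vec K F x i"
proof -
  let ?T = "insert i {j\<in>K. F i j \<noteq> 0}"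
  have T: "finite ?T" "?T \<subseteq> K"
    using assms by (auto simp: row_finite_def)
  have "mat_vec K (\<lambda>i j. id_mat i j + F i j) x i = (\<Sum>j\<in>?T. (id_mat i j + F i j) *\<^sub>R x j)"
    by (rule mat_vec_eq_sum[OF T]) (auto simp: id_mat_def)
  also have "\<dots> = (\<Sum>j\<in>?T. id_mat i j *\<^sub>R x j) + (\<Sum>j\<in>?T. F i j *\<^sub>R x j)"
    by (simp only: scaleR_add_left sum.distrib)
  also have "(\<Sum>j\<in>?T. F i j *\<^sub>R x j) = mat_vec K F x i"
    by (rule mat_vec_eq_sum[OF T, symmetric]) auto
  also have "(\<Sum>j\<in>?T. id_mat i j *\<^sub>R x j) = x i"
    using T(1) by (subst sum.mono_neutral_right[of _ "{i}"]) (auto simp: id_mat_def)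
  finally show ?thesis .
qed


section \<open>Matrices with finite support as operators\<close>

lemma mat_vec_in_l2:
  assumes "finite_support K A"
  shows "in_l2 K (mat_vec K A x)"
  using assms
proof (rule finite_support_obtain)
  fix T assume T: "finite T" "T \<subseteq> K" "\<And>i j. \<lbrakk>i \<in> K; j \<in> K; i \<notin> T \<or> j \<notin> T\<rbrakk> \<Longrightarrow> A i j = 0"
  show ?thesis
    by (rule in_l2_finite_support[OF T(1)]) (use T(3) in \<open>simp add: mat_vec_def infsum_0\<close>)
qed

text \<open>\<open>mat_norm\<close> is a real \<open>Sup\<close>, which says something only for a
  bounded set. Entries of a vector in the unit ball have modulus at most 1, so sums of absolute
  values along the rows give a crude bound.\<close>

lemma bdd_above_mat_norm:
  assumes "finite_support K A"
  shows "bdd_above {l2_norm K (mat_vec K A x) | x :: 'i \<Rightarrow> real. in_l2 K x \<and> l2_norm K x \<le> 1}"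
  using assms
proof (rule finite_support_obtain)
  fix T assume T: "finite T" "T \<subseteq> K" "\<And>i j. \<lbrakk>i \<in> K; j \<in> K; i \<notin> T \<or> j \<notin> T\<rbrakk> \<Longrightarrow> A i j = 0"
  show ?thesis
  proof (rule bdd_aboveI, clarify)
    fix x :: "'i \<Rightarrow> real"
    assume x: "in_l2 K x" "l2_norm K x \<le> 1"
    have "l2_norm K (mat_vec K A x) = L2_set (\<lambda>i. norm (mat_vec K A x i)) T"
      by (rule l2_norm_finite_support[OF T(1,2)]) (use T(3) in \<open>simp add: mat_vec_def infsum_0\<close>)
    also have "\<dots> \<le> L2_set (\<lambda>i. \<Sum>j\<in>T. \<bar>A i j\<bar>) T"
    proof (rule L2_set_mono)
      fix i assume i: "i \<in> T"
      have "mat_vec K A x i = (\<Sum>j\<in>T. A i j *\<^sub>R x j)"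
        by (rule mat_vec_eq_sum[OF T(1,2)]) (use i T(2,3) in auto)
      also have "norm \<dots> \<le> (\<Sum>j\<in>T. \<bar>A i j\<bar>)"
      proof (rule order_trans[OF norm_sum], rule sum_mono)
        fix j assume "j \<in> T"
        then have "norm (x j) \<le> 1"
          using norm_le_l2_norm[OF x(1), of j] x(2) T(2) by auto
        then show "norm (A i j *\<^sub>R x j) \<le> \<bar>A i j\<bar>"
          by (simp add: abs_mult mult_left_le)
      qed
      finally show "norm (mat_vec K A x i) \<le> (\<Sum>j\<in>T. \<bar>A i j\<bar>)" .
    qed simp
    finally show "l2_norm K (mat_vec K A x) \<le> L2_set (\<lambda>i. \<Sum>j\<in>T. \<bar>A i j\<bar>) T" .
  qed
qed

section \<open>Operator norm estimates for real and complex vectors\<close>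

lemma mat_vec_scaleR: "mat_vec K A (\<lambda>i. c *\<^sub>R x i) i = c *\<^sub>R mat_vec K A x i"
  unfolding mat_vec_def
  by (subst infsum_scaleR_right[symmetric]) (simp add: mult.commute)

lemma l2_norm_scaleR: "l2_norm K (\<lambda>i. c *\<^sub>R x i) = \<bar>c\<bar> * l2_norm K x"
  unfolding l2_norm_def
  by (simp add: power_mult_distrib infsum_cmult_right' real_sqrt_mult)

lemma in_l2_scaleR: "in_l2 K x \<Longrightarrow> in_l2 K (\<lambda>i. c *\<^sub>R x i)"
  unfolding in_l2_def by (simp add: power_mult_distrib summable_on_cmult_right)

lemma mat_norm_nonneg:
  assumes "finite_support K A"
  shows "0 \<le> mat_norm K A"
proof -
  have "l2_norm K (mat_vec K A (\<lambda>_. 0 :: real)) \<le> mat_norm K A"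
    unfolding mat_norm_def
    by (rule cSup_upper[OF _ bdd_above_mat_norm[OF assms]])
      (auto intro!: exI[of _ "\<lambda>_. 0"] simp: in_l2_def l2_norm_def)
  then show ?thesis
    using l2_norm_nonneg order_trans by blast
qed

lemma l2_norm_mat_vec_real:
  fixes x :: "'i \<Rightarrow> real"
  assumes A: "finite_support K A" and x: "in_l2 K x"
  shows "l2_norm K (mat_vec K A x) \<le> mat_norm K A * l2_norm K x"
proof (cases "l2_norm K x = 0")
  case True
  then have "\<And>i. i \<in> K \<Longrightarrow> x i = 0"
    using norm_le_l2_norm[OF x] by force
  then have "mat_vec K A x = (\<lambda>_. 0)"
    by (intro ext) (auto simp: mat_vec_def intro!: infsum_0)
  then show ?thesis
    using True by (simp add: l2_norm_def)
next
  case False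
  let ?c = "l2_norm K x"
  have c: "?c > 0"
    using False l2_norm_nonneg[of K x] by simp
  let ?y = "\<lambda>i. inverse ?c *\<^sub>R x i"
  have Ay: "mat_vec K A ?y = (\<lambda>i. inverse ?c *\<^sub>R mat_vec K A x i)"
    by (rule ext) (rule mat_vec_scaleR)
  have y: "in_l2 K ?y" "l2_norm K ?y \<le> 1"
    by (rule in_l2_scaleR[OF x]) (use c in \<open>simp only: l2_norm_scaleR, simp\<close>)
  have "l2_norm K (mat_vec K A ?y) \<le> mat_norm K A"
    unfolding mat_norm_def
    by (intro cSup_upper bdd_above_mat_norm[OF A] CollectI exI[of _ ?y] conjI refl y)
  also have "l2_norm K (mat_vec K A ?y) = inverse ?c * l2_norm K (mat_vec K A x)"
    unfolding Ay l2_norm_scaleR using c by simp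
  finally show ?thesis
    using c by (simp add: field_simps)
qed

lemma l2_complex_split:
  fixes x :: "'i \<Rightarrow> complex"
  assumes "in_l2 K x"
  shows "in_l2 K (\<lambda>i. Re (x i))" "in_l2 K (\<lambda>i. Im (x i))"
    "(l2_norm K x)\<^sup>2 = (l2_norm K (\<lambda>i. Re (x i)))\<^sup>2 + (l2_norm K (\<lambda>i. Im (x i)))\<^sup>2"
proof -
  show Re: "in_l2 K (\<lambda>i. Re (x i))"
    unfolding in_l2_def
    by (rule summable_on_comparison_test[OF assms[unfolded in_l2_def]]) (auto simp: cmod_power2)
  show Im: "in_l2 K (\<lambda>i. Im (x i))"
    unfolding in_l2_def
    by (rule summable_on_comparison_test[OF assms[unfolded in_l2_def]]) (auto simp: cmod_power2)
  show "(l2_norm K x)\<^sup>2 = (l2_norm K (\<lambda>i. Re (x i)))\<^sup>2 + (l2_norm K (\<lambda>i. Im (x i)))\<^sup>2"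
    using Re Im unfolding l2_norm_power2 in_l2_def
    by (subst infsum_add[symmetric]) (auto simp: cmod_power2)
qed

text \<open>\<open>mat_norm\<close> is a supremum over real vectors, whereas eigenvectors are
  complex. A real matrix acts separately on real and imaginary parts, whose squared norms add up, so
  the same constant works.\<close>

lemma l2_norm_mat_vec_complex:
  fixes x :: "'i \<Rightarrow> complex"
  assumes A: "finite_support K A" and x: "in_l2 K x"
  shows "l2_norm K (mat_vec K A x) \<le> mat_norm K A * l2_norm K x"
proof (rule power2_le_imp_le)
  show "0 \<le> mat_norm K A * l2_norm K x"
    by (intro mult_nonneg_nonneg mat_norm_nonneg A l2_norm_nonneg)
  have Re: "Re (mat_vec K A x i) = mat_vec K A (\<lambda>i. Re (x i)) i"
    and Im: "Im (mat_vec K A x i) = mat_vec K A (\<lambda>i. Im (x i)) i" if "i \<in> K" for i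
    by (simp_all add: mat_vec_row_finite[OF finite_support_row_finite[OF A] that])
  note split = l2_complex_split[OF x]
  have "(l2_norm K (mat_vec K A x))\<^sup>2
      = (l2_norm K (mat_vec K A (\<lambda>i. Re (x i))))\<^sup>2 + (l2_norm K (mat_vec K A (\<lambda>i. Im (x i))))\<^sup>2"
    using l2_complex_split(3)[OF mat_vec_in_l2[OF A, of x]]
      l2_norm_cong[of K "\<lambda>i. Re (mat_vec K A x i)", OF Re]
      l2_norm_cong[of K "\<lambda>i. Im (mat_vec K A x i)", OF Im] by simp
  also have "\<dots> \<le> (mat_norm K A * l2_norm K (\<lambda>i. Re (x i)))\<^sup>2
      + (mat_norm K A * l2_norm K (\<lambda>i. Im (x i)))\<^sup>2"
    by (intro add_mono power_mono l2_norm_mat_vec_real A split l2_norm_nonneg)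
  also have "\<dots> = (mat_norm K A * l2_norm K x)\<^sup>2"
    unfolding power_mult_distrib split(3) by (simp add: distrib_left)
  finally show "(l2_norm K (mat_vec K A x))\<^sup>2 \<le> (mat_norm K A * l2_norm K x)\<^sup>2" .
qed

text \<open>The adjoint of a real matrix is its transpose. Both sides reduce to a sum over one
  finite block \<open>T\<close> x \<open>T\<close>, where the order of summation may be
  exchanged.\<close>

lemma inner_mat_vec_transpose:
  fixes x z :: "'i \<Rightarrow> complex"
  assumes "finite_support K F"
  shows "(\<Sum>\<^sub>\<infinity>i\<in>K. cnj (x i) * mat_vec K (mat_transpose F) z i)
    = (\<Sum>\<^sub>\<infinity>i\<in>K. cnj (mat_vec K F x i) * z i)"
  using assms
proof (rule finite_support_obtain)
  fix T assume T: "finite T" "T \<subseteq> K" "\<And>i j. \<lbrakk>i \<in> K; j \<in> K; i \<notin> T \<or> j \<notin> T\<rbrakk> \<Longrightarrow> F i j = 0"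
  have Fx: "mat_vec K F x i = (\<Sum>j\<in>T. F i j *\<^sub>R x j)"
    and Fz: "mat_vec K (mat_transpose F) z i = (\<Sum>j\<in>T. F j i *\<^sub>R z j)" if "i \<in> K" for i
    using mat_vec_eq_sum[OF T(1,2), of F i x] mat_vec_eq_sum[OF T(1,2), of "mat_transpose F" i z]
      T(3) that by (auto simp: mat_transpose_def)
  have "(\<Sum>\<^sub>\<infinity>i\<in>K. cnj (x i) * mat_vec K (mat_transpose F) z i)
      = (\<Sum>\<^sub>\<infinity>i\<in>T. cnj (x i) * mat_vec K (mat_transpose F) z i)"
    by (rule infsum_cong_neutral) (use T in \<open>auto simp: Fz intro!: sum.neutral\<close>)
  also have "\<dots> = (\<Sum>i\<in>T. \<Sum>j\<in>T. cnj (x i) * (F j i *\<^sub>R z j))"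
    using T(1,2) by (auto simp: Fz sum_distrib_left intro!: sum.cong)
  also have "\<dots> = (\<Sum>j\<in>T. \<Sum>i\<in>T. cnj (F j i *\<^sub>R x i) * z j)"
    by (subst sum.swap) (simp add: mult_ac)
  also have "\<dots> = (\<Sum>\<^sub>\<infinity>j\<in>T. cnj (mat_vec K F x j) * z j)"
    using T(1,2) by (auto simp: Fx sum_distrib_right intro!: sum.cong)
  also have "\<dots> = (\<Sum>\<^sub>\<infinity>j\<in>K. cnj (mat_vec K F x j) * z j)"
    by (rule infsum_cong_neutral) (use T in \<open>auto simp: Fx intro!: sum.neutral\<close>)
  finally show ?thesis .
qed


section \<open>Eigenvalues of a finitely perturbed identity\<close>

text \<open>Because \<open>F i i = 0\<close>, the unit entry and column \<open>i\<close> of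
  \<open>F\<close> have disjoint supports, and no cross term appears in the squared column
  norm.\<close>

lemma gram_diag_id_add:
  assumes F: "finite_support K F" and i: "i \<in> K" "F i i = 0"
  defines "H \<equiv> \<lambda>i j. id_mat i j + F i j"
  shows "mat_mult K (mat_transpose H) H i i = 1 + (l2_norm K (\<lambda>m. F m i))\<^sup>2"
proof -
  let ?T = "{m\<in>K. F m i \<noteq> 0}"
  have T: "finite ?T" "i \<notin> ?T"
    using finite_support_col_finite[OF F] i
    by (auto simp: col_finite_def row_finite_def mat_transpose_def)
  have "mat_mult K (mat_transpose H) H i i = (\<Sum>m\<in>insert i ?T. H m i * H m i)"
    by (subst mat_mult_eq_sum[of "insert i ?T"])
      (use T i in \<open>auto simp: H_def id_mat_def mat_transpose_def\<close>)
  also have "\<dots> = 1 + (\<Sum>m\<in>?T. (F m i)\<^sup>2)"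
    using T i by (auto simp: H_def id_mat_def power2_eq_square intro!: sum.cong)
  also have "(\<Sum>m\<in>?T. (F m i)\<^sup>2) = (l2_norm K (\<lambda>m. F m i))\<^sup>2"
    by (subst l2_norm_finite_support[OF T(1)]) (auto simp: L2_set_def sum_nonneg)
  finally show ?thesis .
qed

text \<open>\<open>Max\<close> is a true maximum only on a finite nonempty set. Though
  \<open>K\<close> may be infinite, all columns outside \<open>T\<close> contribute the single value
  0.\<close>

lemma finite_column_norms:
  assumes "finite_support K F"
  shows "finite ((\<lambda>i. (l2_norm K (\<lambda>m. F m i))\<^sup>2) ` K)"
  using assms
proof (rule finite_support_obtain)
  fix T assume T: "finite T" "T \<subseteq> K" "\<And>i j. \<lbrakk>i \<in> K; j \<in> K; i \<notin> T \<or> j \<notin> T\<rbrakk> \<Longrightarrow> F i j = 0"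
  have "(l2_norm K (\<lambda>m. F m i))\<^sup>2 = 0" if "i \<in> K - T" for i
    using that T(3) by (simp add: l2_norm_power2 infsum_0)
  then have "(\<lambda>i. (l2_norm K (\<lambda>m. F m i))\<^sup>2) ` K
      \<subseteq> insert 0 ((\<lambda>i. (l2_norm K (\<lambda>m. F m i))\<^sup>2) ` T)"
    by blast
  then show ?thesis
    using T(1) by (meson finite_imageI finite_insert finite_subset)
qed

text \<open>The analytic core, free of the polynomial basis and of any ordering of the indices: only
  the factorization of \<open>S\<close> and the zero diagonal of \<open>F\<close> enter.\<close>

proposition gram_eigenvalue_bounds:
  fixes F S :: "'i matrix"
  assumes F: "finite_support K F" and F_diag: "\<And>i. i \<in> K \<Longrightarrow> F i i = 0"
    and S: "mat_eq K S (mat_mult K (mat_transpose (\<lambda>i j. id_mat i j + F i j))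
      (\<lambda>i j. id_mat i j + F i j))"
    and small: "mat_norm K F \<le> 1"
    and eigenvalue: "gen_eigenvalue K S (diag_part S) \<mu>"
  shows "\<mu> \<in> \<real>"
    "(1 - mat_norm K F)\<^sup>2 / (1 + Max ((\<lambda>i. (l2_norm K (\<lambda>m. F m i))\<^sup>2) ` K)) \<le> Re \<mu>"
    "Re \<mu> \<le> (1 + mat_norm K (mat_mult K F (diag_inv_sqrt (diag_part S))))\<^sup>2"
proof -
  obtain x k where x: "in_l2 K x" and k: "k \<in> K" "x k \<noteq> 0"
    and eq: "\<And>i. i \<in> K \<Longrightarrow> mat_vec K S x i = \<mu> * mat_vec K (diag_part S) x i"
    using eigenvalue unfolding gen_eigenvalue_def by blast
  define H where "H = (\<lambda>i j. id_mat i j + F i j)"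
  define M where "M = Max ((\<lambda>i. (l2_norm K (\<lambda>m. F m i))\<^sup>2) ` K)"
  \<comment> \<open>\<open>z\<close> is (I + F)x and \<open>y\<close> is D^(1/2) x, chosen so that
    \<open>\<mu>\<close> becomes ||z||^2 / ||y||^2. \<open>C\<close> is F D^(-1/2), so that Cy =
    Fx.\<close>
  define z where "z = (\<lambda>i. x i + mat_vec K F x i)"
  define y where "y = (\<lambda>i. sqrt (S i i) *\<^sub>R x i)"
  define C where "C = mat_mult K F (diag_inv_sqrt (diag_part S))"
  note Ft = finite_support_transpose[OF F]
  have D: "S i i = 1 + (l2_norm K (\<lambda>m. F m i))\<^sup>2" if "i \<in> K" for i
    using gram_diag_id_add[OF F that F_diag[OF that]] S that by (simp add: mat_eq_def)
  \<comment> \<open>These two bounds make the norms of \<open>x\<close> and \<open>y\<close>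
    comparable, and the first one makes the square roots of the diagonal nonzero.\<close>
  have D_ge: "1 \<le> S i i" and D_le: "S i i \<le> 1 + M" if "i \<in> K" for i
    using D[OF that] finite_column_norms[OF F] that by (auto simp: M_def)
  have M_nonneg: "0 \<le> M"
    using D_ge[OF k(1)] D_le[OF k(1)] by linarith

  have H_row: "row_finite K H" and Ht_row: "row_finite K (mat_transpose H)"
    unfolding H_def mat_transpose_id_add
    by (intro row_finite_add row_finite_id finite_support_row_finite F Ft)+
  have Sx: "mat_vec K S x i = z i + mat_vec K (mat_transpose F) z i" if i: "i \<in> K" for i
  proof -
    have "mat_vec K S x i = mat_vec K (mat_mult K (mat_transpose H) H) x i"
      by (rule mat_vec_cong) (use S i in \<open>auto simp: mat_eq_def H_def\<close>)
    also have "\<dots> = mat_vec K (mat_transpose H) (mat_vec K H x) i"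
      by (rule mat_vec_mult[OF Ht_row H_row i])
    also have "\<dots> = mat_vec K (mat_transpose H) z i"
      by (rule mat_vec_cong)
        (auto simp: H_def z_def mat_vec_id_add finite_support_row_finite[OF F])
    also have "\<dots> = z i + mat_vec K (mat_transpose F) z i"
      unfolding H_def mat_transpose_id_add
      by (rule mat_vec_id_add[OF finite_support_row_finite[OF Ft] i])
    finally show ?thesis .
  qed
  have Dx: "mat_vec K (diag_part S) x i = S i i *\<^sub>R x i" if "i \<in> K" for i
    by (subst mat_vec_eq_sum[of "{i}"]) (use that in \<open>auto simp: diag_part_def\<close>)

  have Fx_l2: "in_l2 K (mat_vec K F x)"
    by (rule mat_vec_in_l2[OF F])
  have z_l2: "in_l2 K z"
    unfolding z_def by (rule in_l2_add[OF x Fx_l2])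
  have cnj_l2: "in_l2 K (\<lambda>i. cnj (u i))" if "in_l2 K u" for u
    using that by (simp add: in_l2_def)
  have norm_y: "(norm (y i))\<^sup>2 = S i i * (norm (x i))\<^sup>2" if "i \<in> K" for i
    using D_ge[OF that] by (simp add: y_def power_mult_distrib)
  have y_l2: "in_l2 K y"
    unfolding in_l2_def
  proof (rule summable_on_comparison_test)
    show "(\<lambda>i. (1 + M) * (norm (x i))\<^sup>2) summable_on K"
      using x by (auto simp: in_l2_def intro: summable_on_cmult_right)
    show "(norm (y i))\<^sup>2 \<le> (1 + M) * (norm (x i))\<^sup>2" if "i \<in> K" for i
      using D_le[OF that] by (simp add: norm_y[OF that] mult_right_mono)
  qed auto
  have sum_sq: "(\<Sum>\<^sub>\<infinity>i\<in>K. cnj (u i) * u i) = complex_of_real ((l2_norm K u)\<^sup>2)"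
    if "in_l2 K u" for u
  proof -
    have "((\<lambda>i. complex_of_real ((norm (u i))\<^sup>2)) has_sum complex_of_real ((l2_norm K u)\<^sup>2)) K"
      unfolding l2_norm_power2
      by (intro has_sum_of_real has_sum_infsum) (use that in \<open>simp add: in_l2_def\<close>)
    then show ?thesis
      by (intro infsumI) (simp only: complex_norm_square mult.commute)
  qed

  \<comment> \<open>Splitting and merging the inner products below requires each summand to be
    summable.\<close>
  have xz_summable: "(\<lambda>i. cnj (x i) * z i) summable_on K"
    and Fxz_summable: "(\<lambda>i. cnj (mat_vec K F x i) * z i) summable_on K"
    and xFz_summable: "(\<lambda>i. cnj (x i) * mat_vec K (mat_transpose F) z i) summable_on K"
    by (intro in_l2_mult_summable cnj_l2 x Fx_l2 z_l2 mat_vec_in_l2[OF Ft])+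
  \<comment> \<open>The chain reads <z,z> = <x,z> + <Fx,z> = <x,z> + <x,F^T z> = <x,Sx> =
    \<open>\<mu>\<close> <x,Dx> = \<open>\<mu>\<close> <y,y>.\<close>
  have "complex_of_real ((l2_norm K z)\<^sup>2) = (\<Sum>\<^sub>\<infinity>i\<in>K. cnj (z i) * z i)"
    by (rule sum_sq[OF z_l2, symmetric])
  also have "\<dots> = (\<Sum>\<^sub>\<infinity>i\<in>K. cnj (x i) * z i) + (\<Sum>\<^sub>\<infinity>i\<in>K. cnj (mat_vec K F x i) * z i)"
    by (subst infsum_add[OF xz_summable Fxz_summable, symmetric], rule infsum_cong)
      (simp add: z_def algebra_simps)
  also have "\<dots> = (\<Sum>\<^sub>\<infinity>i\<in>K. cnj (x i) * z i)
      + (\<Sum>\<^sub>\<infinity>i\<in>K. cnj (x i) * mat_vec K (mat_transpose F) z i)"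
    by (simp add: inner_mat_vec_transpose[OF F])
  also have "\<dots> = (\<Sum>\<^sub>\<infinity>i\<in>K. cnj (x i) * mat_vec K S x i)"
    by (subst infsum_add[OF xz_summable xFz_summable, symmetric], rule infsum_cong)
      (simp add: Sx distrib_left)
  also have "\<dots> = (\<Sum>\<^sub>\<infinity>i\<in>K. \<mu> * (cnj (y i) * y i))"
    using D_ge by (intro infsum_cong)
      (force simp: eq Dx y_def scaleR_conv_of_real algebra_simps simp flip: of_real_mult)
  also have "\<dots> = \<mu> * complex_of_real ((l2_norm K y)\<^sup>2)"
    by (simp add: infsum_cmult_right' sum_sq[OF y_l2])
  finally have zy: "complex_of_real ((l2_norm K z)\<^sup>2) = \<mu> * complex_of_real ((l2_norm K y)\<^sup>2)" .

  have xy: "(l2_norm K x)\<^sup>2 \<le> (l2_norm K y)\<^sup>2"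
    unfolding l2_norm_power2
    by (rule infsum_mono)
      (use x y_l2 mult_right_mono[OF D_ge zero_le_power2] in \<open>auto simp: in_l2_def norm_y\<close>)
  have yx: "(l2_norm K y)\<^sup>2 \<le> (1 + M) * (l2_norm K x)\<^sup>2"
    unfolding l2_norm_power2
    by (subst infsum_cmult_right'[symmetric], rule infsum_mono)
      (use x y_l2 D_le in \<open>auto simp: in_l2_def norm_y intro!: mult_right_mono summable_on_cmult_right\<close>)
  have x_pos: "0 < l2_norm K x"
    by (rule l2_norm_pos[OF x k])
  then have y_pos: "0 < (l2_norm K y)\<^sup>2"
    using xy by (meson less_le_trans zero_less_power)
  \<comment> \<open>Realness of the eigenvalue comes from here: it is a quotient of two real squared
    norms with positive denominator.\<close>
  have mu: "\<mu> = complex_of_real ((l2_norm K z)\<^sup>2 / (l2_norm K y)\<^sup>2)"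
    using zy y_pos by (simp add: field_simps)
  then show "\<mu> \<in> \<real>"
    by simp

  \<comment> \<open>Reverse triangle inequality, from x = z - Fx.\<close>
  have "l2_norm K x \<le> l2_norm K z + l2_norm K (\<lambda>i. (-1) *\<^sub>R mat_vec K F x i)"
    using l2_norm_triangle[OF z_l2 in_l2_scaleR[OF Fx_l2, of "-1"]] by (simp add: z_def)
  then have "(1 - mat_norm K F) * l2_norm K x \<le> l2_norm K z"
    using l2_norm_mat_vec_complex[OF F x] l2_norm_scaleR[of K "-1" "mat_vec K F x"]
    by (simp add: algebra_simps)
  \<comment> \<open>Squaring preserves the inequality because \<open>small\<close> makes the left
    factor nonnegative.\<close>
  then have Fxz: "((1 - mat_norm K F) * l2_norm K x)\<^sup>2 \<le> (l2_norm K z)\<^sup>2"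
    using small x_pos by (intro power_mono) auto
  have "(1 - mat_norm K F)\<^sup>2 * (l2_norm K y)\<^sup>2
      \<le> (1 - mat_norm K F)\<^sup>2 * ((1 + M) * (l2_norm K x)\<^sup>2)"
    by (intro mult_left_mono yx zero_le_power2)
  also have "\<dots> = (1 + M) * ((1 - mat_norm K F) * l2_norm K x)\<^sup>2"
    by (simp add: power_mult_distrib mult_ac)
  also have "\<dots> \<le> (1 + M) * (l2_norm K z)\<^sup>2"
    using M_nonneg by (intro mult_left_mono Fxz) simp
  finally have "(1 - mat_norm K F)\<^sup>2 * (l2_norm K y)\<^sup>2 \<le> (1 + M) * (l2_norm K z)\<^sup>2" .
  then show "(1 - mat_norm K F)\<^sup>2 / (1 + Max ((\<lambda>i. (l2_norm K (\<lambda>m. F m i))\<^sup>2) ` K)) \<le> Re \<mu>"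
    using y_pos M_nonneg unfolding M_def[symmetric] mu by (simp add: divide_simps mult_ac)

  have C_entry: "C i j = F i j / sqrt (S j j)" if "j \<in> K" for i j
    unfolding C_def
    by (subst mat_mult_eq_sum[of "{j}"])
      (use that in \<open>auto simp: diag_inv_sqrt_def diag_part_def\<close>)
  have C: "finite_support K C"
    unfolding finite_support_def
    by (rule finite_subset[OF _ F[unfolded finite_support_def]]) (auto simp: C_entry)
  \<comment> \<open>The column scaling by 1/sqrt(S j j) in \<open>C\<close> cancels the scaling in
    \<open>y\<close>.\<close>
  have "mat_vec K C y i = mat_vec K F x i" if "i \<in> K" for i
    unfolding mat_vec_def using D_ge
    by (intro infsum_cong) (fastforce simp: C_entry y_def)
  then have "l2_norm K (mat_vec K F x) \<le> mat_norm K C * l2_norm K y"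
    using l2_norm_mat_vec_complex[OF C y_l2] l2_norm_cong[of K "mat_vec K C y"] by metis
  then have "l2_norm K z \<le> l2_norm K x + mat_norm K C * l2_norm K y"
    using l2_norm_triangle[OF x Fx_l2] by (simp add: z_def)
  \<comment> \<open>The first term is absorbed by ||x|| <= ||y||, which holds since the diagonal is
    at least 1.\<close>
  also have "\<dots> \<le> (1 + mat_norm K C) * l2_norm K y"
    using power2_le_imp_le[OF xy l2_norm_nonneg] by (simp add: algebra_simps)
  finally have "(l2_norm K z)\<^sup>2 \<le> ((1 + mat_norm K C) * l2_norm K y)\<^sup>2"
    by (rule power_mono) (rule l2_norm_nonneg)
  then show "Re \<mu> \<le> (1 + mat_norm K (mat_mult K F (diag_inv_sqrt (diag_part S))))\<^sup>2"
    using y_pos unfolding C_def[symmetric] mu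
    by (simp add: divide_simps power_mult_distrib mult_ac)
qed


section \<open>The truncated Gram--Schmidt matrix\<close>

lemma idx_less_linear: "idx_less k m \<or> k = m \<or> idx_less m k"
  unfolding idx_less_def by (auto simp: prod_eq_iff)

text \<open>Ordering by total degree first leaves finitely many predecessors: a nonzero entry of
  column \<open>k\<close> has row index of total degree at most that of \<open>k\<close>, hence in a
  finite box.\<close>

lemma upper_triangular_col_finite:
  assumes "upper_triangular_on K A"
  shows "col_finite K A"
proof -
  have "finite {m\<in>K. A m k \<noteq> 0}" if "k \<in> K" for k
  proof (rule finite_subset)
    show "{m\<in>K. A m k \<noteq> 0} \<subseteq> {..fst k + snd k} \<times> {..fst k + snd k}"
    proof
      fix m assume "m \<in> {m\<in>K. A m k \<noteq> 0}"
      then have "\<not> idx_less k m"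
        using assms that by (auto simp: upper_triangular_on_def)
      then have "fst m + snd m \<le> fst k + snd k"
        by (auto simp: idx_less_def)
      then show "m \<in> {..fst k + snd k} \<times> {..fst k + snd k}"
        by (auto simp: mem_Times_iff)
    qed
  qed simp
  then show ?thesis
    by (simp add: col_finite_def row_finite_def mat_transpose_def)
qed

text \<open>Every summand \<open>A k l * B l k\<close> vanishes: through \<open>A\<close> if
  \<open>l\<close> precedes \<open>k\<close>, through \<open>B\<close> if \<open>k\<close> precedes
  \<open>l\<close>, and through \<open>B_diag\<close> if they coincide.\<close>

lemma strict_upper_triangular_mult_diag:
  assumes A: "upper_triangular_on K A" and B: "upper_triangular_on K B"
    and B_diag: "\<And>k. k \<in> K \<Longrightarrow> B k k = 0" and k: "k \<in> K"
  shows "mat_mult K A B k k = 0"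
proof -
  have "A k l * B l k = 0" if "l \<in> K" for l
    using idx_less_linear[of k l] A B B_diag[OF that] k that by (auto simp: upper_triangular_on_def)
  then show ?thesis
    unfolding mat_mult_def by (intro infsum_0)
qed

text \<open>This is (GH)^T S (GH) = H^T (G^T S G) H = H^T H. As \<open>S\<close> may have infinite
  rows and columns, each regrouping relies on finite rows of the transposed factors on its left or
  finite columns of the factors on its right.\<close>

lemma gram_of_mult:
  assumes G: "col_finite K G" and H: "col_finite K H"
    and orth: "mat_eq K (mat_mult K (mat_mult K (mat_transpose G) S) G) id_mat"
    and P: "mat_eq K P (mat_mult K G H)"
  shows "mat_eq K (mat_mult K (mat_mult K (mat_transpose P) S) P) (mat_mult K (mat_transpose H) H)"
  unfolding mat_eq_def
proof (intro ballI)
  fix i j assume ij: "i \<in> K" "j \<in> K"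
  let ?T = mat_transpose
  have rows: "row_finite K (?T G)" "row_finite K (?T H)"
    using G H by (simp_all add: col_finite_def)
  have P': "P l m = mat_mult K G H l m" if "l \<in> K" "m \<in> K" for l m
    using P that by (simp add: mat_eq_def)
  have PS: "mat_mult K (?T P) S i l = mat_mult K (?T H) (mat_mult K (?T G) S) i l" for l
  proof -
    have "mat_mult K (?T P) S i l = mat_mult K (mat_mult K (?T H) (?T G)) S i l"
      by (rule mat_mult_cong)
        (use ij P' in \<open>auto simp: mat_transpose_mult[symmetric] mat_transpose_def\<close>)
    then show ?thesis
      by (simp add: mat_mult_assoc_row[OF rows(2,1) ij(1)])
  qed
  have "mat_mult K (mat_mult K (?T P) S) P i j
      = mat_mult K (mat_mult K (?T H) (mat_mult K (?T G) S)) (mat_mult K G H) i j"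
    by (rule mat_mult_cong) (use ij in \<open>auto simp: PS P'\<close>)
  also have "\<dots> = mat_mult K (mat_mult K (mat_mult K (?T H) (mat_mult K (?T G) S)) G) H i j"
    by (rule mat_mult_assoc_col[OF G H ij(2), symmetric])
  also have "\<dots> = mat_mult K (?T H) H i j"
  proof (rule mat_mult_cong)
    fix l assume l: "l \<in> K"
    have "mat_mult K (mat_mult K (?T H) (mat_mult K (?T G) S)) G i l
        = mat_mult K (?T H) (mat_mult K (mat_mult K (?T G) S) G) i l"
      by (rule mat_mult_assoc_row_col[OF rows(2) G ij(1) l])
    also have "\<dots> = mat_mult K (?T H) id_mat i l"
      by (rule mat_mult_cong) (use orth l in \<open>auto simp: mat_eq_def\<close>)
    also have "\<dots> = ?T H i l"
      by (rule mat_mult_id_right[OF l])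
    finally show "mat_mult K (mat_mult K (?T H) (mat_mult K (?T G) S)) G i l = ?T H i l" .
  qed simp
  finally show "mat_mult K (mat_mult K (?T P) S) P i j = mat_mult K (?T H) H i j" .
qed

theorem proposition2p3:
  fixes p q :: bool
    and K :: "(nat \<times> nat) set"
    and G L G\<^sub>t E S\<^sub>\<phi> D\<^sub>\<phi> F :: "(nat \<times> nat) matrix"
    and Z :: "((nat \<times> nat) \<times> (nat \<times> nat)) set"
    and \<mu> :: complex
  assumes K: "K = family p q"
    and G_upper: "upper_triangular_on K G"
    and G_diag: "\<forall>k\<in>K. G k k \<noteq> 0"
    and G_orthonormal: "mat_eq K (mat_mult K (mat_mult K (mat_transpose G) S_eta) G) id_mat"
    and L_lower: "lower_triangular_on K L"
    and L_inverse: "mat_inverse_on K (mat_transpose G) L"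
    and Z_finite: "finite Z"
    and Gt: "G\<^sub>t = (\<lambda>m k. if (m, k) \<in> Z then 0 else G m k)"
    and Gt_diag: "\<forall>k\<in>K. G\<^sub>t k k = G k k"
    and E: "E = (\<lambda>m k. G\<^sub>t m k - G m k)"
    and S_phi: "S\<^sub>\<phi> = mat_mult K (mat_mult K (mat_transpose G\<^sub>t) S_eta) G\<^sub>t"
    and D_phi: "D\<^sub>\<phi> = diag_part S\<^sub>\<phi>"
    and F: "F = mat_mult K (mat_transpose L) E"
    and small: "mat_norm K F < 1"
    and eigenvalue: "gen_eigenvalue K S\<^sub>\<phi> D\<^sub>\<phi> \<mu>"
  shows "\<mu> \<in> \<real>
    \<and> (1 - mat_norm K F)\<^sup>2 / (1 + Max ((\<lambda>i. (l2_norm K (\<lambda>m. F m i))\<^sup>2) ` K)) \<le> Re \<mu>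
    \<and> Re \<mu> \<le> (1 + mat_norm K (mat_mult K F (diag_inv_sqrt D\<^sub>\<phi>)))\<^sup>2"
proof -
  let ?H = "\<lambda>i j. id_mat i j + F i j"
  have G_col: "col_finite K G"
    by (rule upper_triangular_col_finite[OF G_upper])
  have Lt_upper: "upper_triangular_on K (mat_transpose L)"
    using L_lower by (simp add: lower_triangular_on_def)
  note Lt_col = upper_triangular_col_finite[OF Lt_upper]
  \<comment> \<open>Truncation changes only entries in \<open>Z\<close>, where it subtracts the
    entry of \<open>G\<close>; so \<open>E\<close> has finite support and inherits the triangular
    shape.\<close>
  have E_entry: "E m k = (if (m, k) \<in> Z then - G m k else 0)" for m k
    by (simp add: E Gt)
  have E_fin: "finite_support K E"
    unfolding finite_support_def
    by (rule finite_subset[OF _ Z_finite]) (auto simp: E_entry split: if_splits)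
  have E_upper: "upper_triangular_on K E"
    using G_upper by (simp add: upper_triangular_on_def E_entry)
  have E_diag: "E k k = 0" if "k \<in> K" for k
    using Gt_diag that by (simp add: E)
  have F_fin: "finite_support K F"
    unfolding F by (rule finite_support_mult[OF Lt_col E_fin])
  have F_diag: "F k k = 0" if "k \<in> K" for k
    unfolding F by (rule strict_upper_triangular_mult_diag[OF Lt_upper E_upper E_diag that])
  have H_col: "col_finite K ?H"
    unfolding col_finite_def mat_transpose_id_add
    by (intro row_finite_add row_finite_id finite_support_row_finite finite_support_transpose F_fin)
  \<comment> \<open>The second half of \<open>L_inverse\<close>, L G^T = I, transposed.\<close>
  have GLt: "mat_mult K G (mat_transpose L) i j = id_mat i j" if "i \<in> K" "j \<in> K" for i j
  proof -
    have "mat_mult K G (mat_transpose L) i j = mat_mult K L (mat_transpose G) j i"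
      by (metis mat_transpose_def mat_transpose_mult mat_transpose_transpose)
    then show ?thesis
      using L_inverse that by (simp add: mat_inverse_on_def mat_eq_def id_mat_def)
  qed
  \<comment> \<open>Since GF = G L^T E = E, adding \<open>G\<close> yields G(I + F) = G + E, which
    is \<open>G\<^sub>t\<close>.\<close>
  have GF: "mat_mult K G F i j = E i j" if ij: "i \<in> K" "j \<in> K" for i j
  proof -
    have "mat_mult K G F i j = mat_mult K (mat_mult K G (mat_transpose L)) E i j"
      unfolding F
      by (rule mat_mult_assoc_col[OF Lt_col finite_support_col_finite[OF E_fin] ij(2), symmetric])
    also have "\<dots> = mat_mult K id_mat E i j"
      by (rule mat_mult_cong) (use ij GLt in auto)
    finally show ?thesis
      by (simp add: mat_mult_id_left[OF ij(1)])
  qed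
  have "mat_eq K G\<^sub>t (mat_mult K G ?H)"
    unfolding mat_eq_def
  proof (intro ballI)
    fix i j assume ij: "i \<in> K" "j \<in> K"
    \<comment> \<open>Row \<open>i\<close> of \<open>G\<close> is treated as a vector on which the
      transpose of I + F acts; this allows \<open>mat_vec_id_add\<close> to split the sum although
      that row may be infinite.\<close>
    have "mat_mult K G ?H i j = mat_vec K (mat_transpose ?H) (\<lambda>l. G i l) j"
      by (simp add: mat_mult_def mat_vec_def mat_transpose_def mult.commute)
    also have "\<dots> = G i j + mat_vec K (mat_transpose F) (\<lambda>l. G i l) j"
      unfolding mat_transpose_id_add
      by (rule mat_vec_id_add[OF finite_support_row_finite[OF finite_support_transpose[OF F_fin]] ij(2)])
    also have "mat_vec K (mat_transpose F) (\<lambda>l. G i l) j = mat_mult K G F i j"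
      by (simp add: mat_mult_def mat_vec_def mat_transpose_def mult.commute)
    finally show "G\<^sub>t i j = mat_mult K G ?H i j"
      by (simp add: GF[OF ij] E)
  qed
  then have "mat_eq K S\<^sub>\<phi> (mat_mult K (mat_transpose ?H) ?H)"
    unfolding S_phi by (rule gram_of_mult[OF G_col H_col G_orthonormal])
  from gram_eigenvalue_bounds[OF F_fin F_diag this less_imp_le[OF small] eigenvalue[unfolded D_phi]]
  show ?thesis
    unfolding D_phi by blast
qed

end
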